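(* Let $r\ge 1$ be an integer, let $f\colon(0,\infty)\to(0,\infty)$ be a nearly logarithmic function, and let $\mathcal G$ be a hereditary class of $(r+1)$-uniform hypergraphs. Suppose that for every $\delta>0$ there exists $\Delta_0$ such that every hypergraph $H\in\mathcal G$ with $\Delta(H)\ge\Delta_0$ satisfies $$\alpha(H)\ge(1-\delta)\,\frac{f(\Delta(H))}{\Delta(H)^{1/r}}\,|V(H)|.$$ Then for every $\varepsilon>0$ there exists $d_0$ such that every $H\in\mathcal G$ with $d(H)\ge d_0$ satisfies $$\alpha(H)\ge(1-\varepsilon)\,\frac{f(d(H))}{d(H)^{1/r}}\,|V(H)|.$$
   Context: Hypergraphs are finite and simple: an $(r+1)$-uniform hypergraph $H$ consists of a finite vertex set $V(H)$ and a set $E(H)$ of $(r+1)$-element subsets of $V(H)$. The degree of a vertex is the number of edges containing it; $\Delta(H)$ is the maximum degree and $d(H)=(r+1)|E(H)|/|V(H)|$ is the average degree. A set $I\subseteq V(H)$ is independent if it contains no edge of $H$, and $\alpha(H)$ is the maximum size of an independent set. For $U\subseteq V(H)$, the induced subhypergraph $H[U]$ has vertex set $U$ and edge set $\{e\in E(H): e\subseteq U\}$. A class of hypergraphs is hereditary if every induced subhypergraph of a member of the class belongs to the class. The thresholds $\Delta_0,d_0$ are positive real numbers. A function $f\colon(0,\infty)\to(0,\infty)$ is nearly logarithmic if both of the following hold: (C1) $f(x)=x^{o(1)}$ as $x\to+\infty$ (i.e. $\log f(x)/\log x\to0$), and $\liminf_{x\to\infty}f(x)>2$; (C2) for any $\varepsilon>0$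 and $m\ge0$ there exist $M>0$ and $\lambda>1$ such that for every $x>M$, $$\inf_{y\in[xf(x)^{-m},\,\lambda x]}\frac{f(y)}{f(x)}\ge1-\varepsilon.$$ *)

theory Defs
  imports "HOL-Analysis.Analysis"
begin

datatype 'a hypergraph = Hypergraph (verts: "'a set") (edges: "'a set set")

definition uniform_hypergraph :: "nat \<Rightarrow> 'a hypergraph \<Rightarrow> bool" where
  "uniform_hypergraph k H \<longleftrightarrow>
     finite (verts H) \<and> (\<forall>e\<in>edges H. e \<subseteq> verts H \<and> card e = k)"

definition degree :: "'a hypergraph \<Rightarrow> 'a \<Rightarrow> nat" where
  "degree H v = card {e \<in> edges H. v \<in> e}"

text \<open>The inserted 0 only matters for the hypergraph without vertices.\<close>

definition max_degree :: "'a hypergraph \<Rightarrow> nat" where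
  "max_degree H = Max (insert 0 (degree H ` verts H))"

text \<open>Average degree of a \<open>k\<close>-uniform hypergraph; it is 0 if there are no vertices.\<close>

definition avg_degree :: "nat \<Rightarrow> 'a hypergraph \<Rightarrow> real" where
  "avg_degree k H = real k * real (card (edges H)) / real (card (verts H))"

definition independent_set :: "'a hypergraph \<Rightarrow> 'a set \<Rightarrow> bool" where
  "independent_set H I \<longleftrightarrow> I \<subseteq> verts H \<and> (\<forall>e\<in>edges H. \<not> e \<subseteq> I)"

definition independence_number :: "'a hypergraph \<Rightarrow> nat" where
  "independence_number H = Max {card I |I. independent_set H I}"

definition induced :: "'a hypergraph \<Rightarrow> 'a set \<Rightarrow> 'a hypergraph" where
  "induced H U = Hypergraph U {e \<in> edges H. e \<subseteq> U}"

definition hereditary :: "'a hypergraph set \<Rightarrow> bool" where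
  "hereditary \<G> \<longleftrightarrow> (\<forall>H\<in>\<G>. \<forall>U. U \<subseteq> verts H \<longrightarrow> induced H U \<in> \<G>)"

text \<open>
  Intended for functions from the positive reals to the positive reals; values at
  nonpositive arguments are never used. The limit inferior and the infimum are taken
  in the extended reals, so that an infimum over an empty interval is infinite.
\<close>

definition nearly_logarithmic :: "(real \<Rightarrow> real) \<Rightarrow> bool" where
  "nearly_logarithmic f \<longleftrightarrow>
     ((\<lambda>x. ln (f x) / ln x) \<longlongrightarrow> 0) at_top \<and>
     Liminf at_top (\<lambda>x. ereal (f x)) > 2 \<and>
     (\<forall>\<epsilon>>0. \<forall>m\<ge>0. \<exists>M>0. \<exists>l>1. \<forall>x>M.
        (INF y\<in>{x * f x powr (- m)..l * x}. ereal (f y / f x)) \<ge> ereal (1 - \<epsilon>))"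

end

theory Submission imports Defs begin

text \<open>
  Write \<open>d\<close> and \<open>n\<close> for the average degree and the number of vertices of \<open>H\<close>, and call
  \<open>|U| / d(H[U])^(1/r)\<close> the value of a vertex set \<open>U\<close>. Up to the factor \<open>f\<close>, the value is the
  size of the independent set that the hypothesis would give in \<open>H[U]\<close> if \<open>H[U]\<close> were regular.
  The idea is to look for a set \<open>U\<close> that is nearly regular and has at least the value
  \<open>n / d^(1/r)\<close> of the whole vertex set.

  Delete a vertex of maximum degree again and again. As the maximum degree is at least the average
  degree, the number of edges falls at least as fast as the \<open>(r+1)\<close>-st power of the number of
  vertices, so the value never decreases. If moreover the maximum degree exceeds \<open>1 + \<gamma>\<close> times the
  average degree during the whole process, the exponent improves to \<open>(r+1)(1+\<gamma>)\<close>, and a set with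
  \<open>q n\<close> vertices has a value of at least \<open>q^(-\<gamma>) n / d^(1/r)\<close>
  (\<open>peel_max_degree_vertices\<close>, \<open>exists_sparse_or_nearly_regular_subset\<close>). The process stops at the
  first set \<open>U\<close> whose maximum degree is at most \<open>1 + \<gamma>\<close> times its average degree, or when only
  about \<open>n f(d)^(-m)\<close> vertices are left, where \<open>m\<close> is a large constant. There are three cases.

  If \<open>U\<close> is nearly regular and its average degree is at least \<open>d\<close> times a fixed negative power of
  \<open>f(d)\<close>, then \<open>f\<close> at the maximum degree of \<open>H[U]\<close> is almost at least \<open>f(d)\<close>, and the hypothesis
  applied to \<open>H[U]\<close> gives the claim. Otherwise the value of \<open>U\<close> is larger than \<open>n / d^(1/r)\<close> by a
  factor of at least \<open>f(d)^3\<close>: either \<open>U\<close> has at least \<open>n f(d)^(-m)\<close> vertices but an extremely small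
  average degree, or the process ran down to the end and \<open>q^(-\<gamma>)\<close> is that large. In these cases a
  Turan-type bound, which finds an independent set of one quarter of the value
  (\<open>Turan_independence_bound\<close>), suffices. This is where the lower bound 2 for \<open>f\<close> enters:
  it makes \<open>f(d)^3 / 4\<close> at least \<open>f(d)\<close>.

  The constants have to be chosen in the right order. The number \<open>m\<close> depends on \<open>\<gamma>\<close>, and \<open>\<gamma>\<close>
  depends on how far to the right of \<open>d\<close> the function \<open>f\<close> is stable, which condition (C2) only
  gives in terms of \<open>m\<close>. The lemma \<open>nearly_logarithmic_stable\<close> removes this circularity.
\<close>

section \<open>Degrees, edges and independent sets\<close>

abbreviation edge_count :: "'a hypergraph \<Rightarrow> 'a set \<Rightarrow> nat" where
  "edge_count H U \<equiv> card (edges (induced H U))"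

lemma verts_induced [simp]: "verts (induced H U) = U"
  by (simp add: induced_def)

lemma edges_induced [simp]: "edges (induced H U) = {e \<in> edges H. e \<subseteq> U}"
  by (simp add: induced_def)

lemma uniform_induced:
  assumes "uniform_hypergraph k H" "U \<subseteq> verts H"
  shows "uniform_hypergraph k (induced H U)"
  using assms by (auto simp: uniform_hypergraph_def intro: finite_subset)

lemma uniform_finite_edges:
  assumes "uniform_hypergraph k H"
  shows "finite (edges H)"
proof -
  have "edges H \<subseteq> Pow (verts H)" "finite (Pow (verts H))"
    using assms by (auto simp: uniform_hypergraph_def)
  then show ?thesis by (rule finite_subset)
qed

lemma card_le_independence_number:
  assumes "finite (verts H)" "independent_set H I"
  shows "card I \<le> independence_number H"
proof -
  have "{card I |I. independent_set H I} \<subseteq> card ` Pow (verts H)"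
    by (auto simp: independent_set_def)
  then have "finite {card I |I. independent_set H I}"
    using assms(1) by (meson finite_Pow_iff finite_imageI finite_subset)
  then show ?thesis
    unfolding independence_number_def using assms(2) by (intro Max_ge) auto
qed

lemma independence_number_induced_le:
  assumes "uniform_hypergraph (Suc r) H" "U \<subseteq> verts H"
  shows "independence_number (induced H U) \<le> independence_number H"
proof -
  have fin: "finite (verts H)" using assms(1) by (simp add: uniform_hypergraph_def)
  then have "finite U" using assms(2) finite_subset by blast
  have "independent_set (induced H U) {}"
    using assms(1) by (auto simp: independent_set_def uniform_hypergraph_def)
  moreover have "{card I |I. independent_set (induced H U) I} \<subseteq> card ` Pow U"
    by (auto simp: independent_set_def)
  ultimately have "independence_number (induced H U) \<in> {card I |I. independent_set (induced H U) I}"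
    unfolding independence_number_def using \<open>finite U\<close>
    by (intro Max_in) (auto intro: finite_subset[of _ "card ` Pow U"])
  then obtain I where I: "independence_number (induced H U) = card I"
      "independent_set (induced H U) I"
    by auto
  then have "independent_set H I"
    using assms(2) unfolding independent_set_def edges_induced verts_induced by blast
  then show ?thesis
    using card_le_independence_number[OF fin] I(1) by simp
qed

lemma max_degree_attained:
  assumes "finite (verts H)" "verts H \<noteq> {}"
  obtains v where "v \<in> verts H" "degree H v = max_degree H"
proof -
  have "max_degree H = Max (degree H ` verts H)"
    unfolding max_degree_def using assms by simp
  also have "\<dots> \<in> degree H ` verts H"
    using assms by (intro Max_in) auto
  finally show ?thesis using that by force
qed

text \<open>
  Double counting of the incidences between vertices and edges.
\<close>

lemma avg_degree_le_max_degree: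
  assumes "uniform_hypergraph k H"
  shows "avg_degree k H \<le> real (max_degree H)"
proof (cases "verts H = {}")
  case True
  then show ?thesis by (simp add: avg_degree_def)
next
  case False
  have fin: "finite (verts H)" using assms by (simp add: uniform_hypergraph_def)
  have edge: "{v \<in> verts H. v \<in> e} = e" "card e = k" if "e \<in> edges H" for e
    using assms that by (auto simp: uniform_hypergraph_def)
  have "k * card (edges H) = (\<Sum>v\<in>verts H. degree H v)"
    unfolding degree_def
    by (rule sum_multicount[symmetric]) (use fin uniform_finite_edges[OF assms] edge in auto)
  also have "\<dots> \<le> card (verts H) * max_degree H"
    using fin by (intro sum_bounded_above[where 'a = nat, simplified]) (auto simp: max_degree_def)
  finally have "real k * real (card (edges H)) \<le> real (card (verts H)) * real (max_degree H)"
    by (metis of_nat_le_iff of_nat_mult)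
  moreover have "card (verts H) > 0" using fin False by (simp add: card_gt_0_iff)
  ultimately show ?thesis
    by (simp add: avg_degree_def divide_le_eq mult.commute)
qed

lemma avg_degree_le_power:
  assumes "uniform_hypergraph (Suc r) H"
  shows "avg_degree (Suc r) H \<le> real (card (verts H)) ^ r"
proof (cases "card (verts H) = 0")
  case True
  then show ?thesis by (simp add: avg_degree_def)
next
  case False
  define n where "n = card (verts H)"
  have fin: "finite (verts H)" using assms by (simp add: uniform_hypergraph_def)
  have "card (edges H) \<le> card {e. e \<subseteq> verts H \<and> card e = Suc r}"
    using assms fin by (intro card_mono) (auto simp: uniform_hypergraph_def)
  also have "\<dots> = n choose (Suc r)"
    using fin by (simp add: n_subsets n_def)
  finally have "Suc r * card (edges H) \<le> fact (Suc r) * (n choose (Suc r))"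
    by (intro mult_mono fact_ge_self) auto
  also have "\<dots> \<le> n ^ Suc r"
    using binomial_fact_pow[of n "Suc r"] by (simp only: mult.commute)
  finally have "real (Suc r * card (edges H)) \<le> real (n ^ Suc r)"
    by (simp only: of_nat_le_iff)
  then have "real (Suc r) * real (card (edges H)) \<le> real n * real n ^ r"
    by (simp only: of_nat_mult of_nat_power power_Suc)
  then show ?thesis
    using False by (simp add: avg_degree_def n_def divide_le_eq mult.commute)
qed

text \<open>
  Delete one vertex of every edge.
\<close>

lemma independence_number_ge_verts_minus_edges:
  assumes "uniform_hypergraph (Suc r) H"
  shows "card (verts H) \<le> independence_number H + card (edges H)"
proof -
  have fin: "finite (verts H)" using assms by (simp add: uniform_hypergraph_def)
  have "e \<noteq> {}" if "e \<in> edges H" for e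
    using assms that by (force simp: uniform_hypergraph_def)
  then have "\<forall>e\<in>edges H. \<exists>v. v \<in> e" by blast
  then obtain pick where pick: "\<forall>e\<in>edges H. pick e \<in> e"
    using bchoice by metis
  have "independent_set H (verts H - pick ` edges H)"
    using pick by (auto simp: independent_set_def)
  then have "card (verts H - pick ` edges H) \<le> independence_number H"
    by (rule card_le_independence_number[OF fin])
  moreover have "card (verts H) \<le> card (verts H - pick ` edges H) + card (pick ` edges H)"
    using diff_card_le_card_Diff[of "pick ` edges H" "verts H"] uniform_finite_edges[OF assms]
    by simp
  moreover have "card (pick ` edges H) \<le> card (edges H)"
    using uniform_finite_edges[OF assms] by (rule card_image_le)
  ultimately show ?thesis by linarith
qed

section \<open>Peeling off vertices of maximum degree\<close>

text \<open>
  The graph of the convex function \<open>t powr a\<close> lies above its tangent at 1.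
\<close>

lemma Bernoulli_inequality_powr:
  fixes a t :: real
  assumes "1 \<le> a" "0 < t"
  shows "1 - a * (1 - t) \<le> t powr a"
proof -
  have "t powr a - 1 powr a \<ge> (a * 1 powr (a - 1)) * (t - 1)"
    by (rule convex_on_imp_above_tangent[OF powr_convex[OF assms(1)]])
       (use assms in \<open>auto intro!: derivative_eq_intros simp: interior_open\<close>)
  then show ?thesis by (simp add: algebra_simps)
qed

text \<open>
  When the maximum degree is at least \<open>a\<close> times the number of edges per vertex, deleting a vertex
  of maximum degree from a set of size \<open>w\<close> multiplies the number of edges by at most \<open>1 - a / w\<close>.
  By Bernoulli's inequality this is at most \<open>((w - 1) / w) powr a\<close>, and these factors telescope.
  The predicate \<open>good\<close> is the stopping condition. It never holds in the proof of the Turan-type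
  bound, and it is near-regularity in the main argument.
\<close>

lemma peel_max_degree_vertices:
  fixes a :: real
  assumes H: "uniform_hypergraph k H" and a: "1 \<le> a"
    and l: "1 \<le> l" "l \<le> card (verts H)"
    and steep: "\<And>W. W \<subseteq> verts H \<Longrightarrow> W \<noteq> {} \<Longrightarrow> \<not> good W \<Longrightarrow>
      a * real (edge_count H W) / real (card W) \<le> real (max_degree (induced H W))"
  shows "\<exists>U\<subseteq>verts H. l \<le> card U \<and>
      real (edge_count H U) \<le>
        real (card (edges H)) * (real (card U) / real (card (verts H))) powr a \<and>
      (card U = l \<or> good U)"
  using l(2) l(1)
proof (induction l rule: inc_induct)
  case base
  have "edges (induced H (verts H)) = edges H"
    using H by (auto simp: uniform_hypergraph_def)
  then show ?case using base by (intro exI[of _ "verts H"]) auto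
next
  case (step l)
  define n where "n = card (verts H)"
  obtain U where U: "U \<subseteq> verts H" "Suc l \<le> card U" "card U = Suc l \<or> good U"
    and EU: "real (edge_count H U) \<le> real (card (edges H)) * (real (card U) / real n) powr a"
    using step.IH unfolding n_def by auto
  show ?case
  proof (cases "good U")
    case True
    then show ?thesis using U EU unfolding n_def by (intro exI[of _ U]) auto
  next
    case False
    then have cU: "card U = Suc l" using U by simp
    have finU: "finite U" using cU by (metis card.infinite nat.simps(3))
    have "U \<noteq> {}" using cU by auto
    then obtain v where v: "v \<in> U" "degree (induced H U) v = max_degree (induced H U)"
      using max_degree_attained[of "induced H U"] finU by auto
    define W where "W = U - {v}"
    have cW: "card W = l" using cU v(1) finU by (simp add: W_def)
    have finE: "finite (edges (induced H U))"
      using uniform_finite_edges[OF uniform_induced[OF H U(1)]] .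
    have split: "edges (induced H U) =
        edges (induced H W) \<union> {e \<in> edges (induced H U). v \<in> e}"
      by (auto simp: W_def)
    have "edge_count H U = edge_count H W + degree (induced H U) v"
      unfolding degree_def
      by (subst split, rule card_Un_disjoint) (use finE in \<open>auto simp: W_def elim: rev_finite_subset\<close>)
    then have EW: "real (edge_count H W) =
        real (edge_count H U) - real (max_degree (induced H U))"
      using v(2) by linarith
    define t where "t = real l / real (Suc l)"
    have t: "0 < t" "1 - t = 1 / real (Suc l)"
      using step.prems by (auto simp: t_def field_simps)
    have "real (edge_count H W) \<le> real (edge_count H U) * (1 - a * (1 - t))"
      using steep[OF U(1) \<open>U \<noteq> {}\<close> False] unfolding EW cU t(2)
      by (simp add: algebra_simps)
    also have "\<dots> \<le> real (edge_count H U) * t powr a"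
      using Bernoulli_inequality_powr[OF a t(1)] by (intro mult_left_mono) auto
    also have "\<dots> \<le> real (card (edges H)) * (real (Suc l) / real n) powr a * t powr a"
      using EU cU by (intro mult_right_mono) auto
    also have "\<dots> = real (card (edges H)) * (real (Suc l) / real n * t) powr a"
      using t(1) by (subst powr_mult) auto
    also have "real (Suc l) / real n * t = real (card W) / real n"
      by (simp add: t_def cW)
    finally show ?thesis
      using U(1) cW unfolding n_def by (intro exI[of _ W]) (auto simp: W_def)
  qed
qed

section \<open>A Turan-type bound\<close>

text \<open>
  Peel down to about \<open>n / x\<close> vertices. As every vertex set has average degree at most its maximum
  degree, the exponent \<open>r + 1\<close> is available, and the remaining set has at most half as many edges as
  vertices. Deleting a vertex of each edge leaves an independent set. The bound is stated with an
  upper bound \<open>x\<close> for the \<open>r\<close>-th root of the average degree, and \<open>1 \<le> x\<close>, because the average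
  degree may be close to 0, and then \<open>n\<close> divided by its root may exceed the number of vertices.
\<close>

lemma Turan_independence_bound:
  fixes x :: real
  assumes H: "uniform_hypergraph (Suc r) H" and r: "1 \<le> r" and x: "1 \<le> x"
    and d: "avg_degree (Suc r) H \<le> x ^ r"
  shows "real (card (verts H)) / (4 * x) \<le> real (independence_number H)"
proof (cases "verts H = {}")
  case True
  then show ?thesis by simp
next
  case False
  define n where "n = card (verts H)"
  have fin: "finite (verts H)" using H by (simp add: uniform_hypergraph_def)
  then have n: "0 < n" using False by (simp add: n_def card_gt_0_iff)
  show ?thesis
  \<comment> \<open>In the first case \<open>n / x\<close> rounds down to 0, but a single vertex is large enough.\<close>
  proof (cases "real n < x")
    case True
    obtain v where v: "v \<in> verts H" using False by blast
    have "independent_set H {v}"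
      unfolding independent_set_def
    proof (intro conjI ballI notI)
      show "{v} \<subseteq> verts H" using v by simp
    next
      fix e assume "e \<in> edges H" "e \<subseteq> {v}"
      then have "card e = Suc r" "card e \<le> card {v}"
        using H card_mono[of "{v}" e] by (auto simp: uniform_hypergraph_def)
      then show False using r by simp
    qed
    then have "1 \<le> independence_number H"
      using card_le_independence_number[OF fin, of "{v}"] by simp
    moreover have "real n / (4 * x) \<le> 1" using True x by (simp add: divide_le_eq)
    ultimately show ?thesis unfolding n_def by linarith
  next
    case False
    define l where "l = nat \<lfloor>real n / x\<rfloor>"
    have nx: "1 \<le> real n / x" using False x by (simp add: le_divide_eq)
    have l_le: "real l \<le> real n / x" using nx unfolding l_def by linarith
    have l1: "1 \<le> l" using nx by (simp add: l_def le_nat_iff)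
    have l_ge: "real n / (2 * x) \<le> real l"
    proof -
      have "real n / x < real l + 1" using nx unfolding l_def by linarith
      moreover have "1 \<le> real l" using l1 by simp
      ultimately have "real n / x \<le> 2 * real l" by linarith
      then show ?thesis using x by (simp add: field_simps)
    qed
    have "real n / x \<le> real n" using x n by (simp add: divide_le_eq)
    then have ln: "l \<le> n" using l_le by linarith
    have "real (Suc r) * real (edge_count H W) / real (card W)
        \<le> real (max_degree (induced H W))" if "W \<subseteq> verts H" for W
      using avg_degree_le_max_degree[OF uniform_induced[OF H that]]
      by (simp add: avg_degree_def)
    then have "\<exists>U\<subseteq>verts H. l \<le> card U \<and> real (edge_count H U) \<le> real (card (edges H)) *
        (real (card U) / real (card (verts H))) powr real (Suc r) \<and> (card U = l \<or> False)"
      using l1 ln unfolding n_def by (intro peel_max_degree_vertices[OF H]) auto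
    then obtain U where U: "U \<subseteq> verts H" "card U = l" and
      EU: "real (edge_count H U) \<le> real (card (edges H)) * (real l / real n) powr real (Suc r)"
      unfolding n_def by auto
    have "(real l / real n) powr real (Suc r) = (real l / real n) ^ Suc r"
      using l1 n by (intro powr_realpow) simp
    then have "real (Suc r) * real (edge_count H U)
        \<le> real (Suc r) * (real (card (edges H)) * (real l / real n) ^ Suc r)"
      using EU by (intro mult_left_mono) (simp_all only: of_nat_0_le_iff)
    also have "\<dots> = real (Suc r) * real (card (edges H)) * (real l / real n) ^ Suc r"
      by (simp only: mult.assoc)
    also have "real (Suc r) * real (card (edges H)) = avg_degree (Suc r) H * real n"
      using n by (simp add: avg_degree_def n_def)
    also have "avg_degree (Suc r) H * real n * (real l / real n) ^ Suc r
        \<le> x ^ r * real n * (real l / real n) ^ Suc r"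
      using d by (intro mult_right_mono) auto
    also have "\<dots> = (x * real l / real n) ^ r * real l"
      using n by (simp add: power_mult_distrib power_divide)
    also have "\<dots> \<le> 1 ^ r * real l"
      using l_le n x by (intro mult_right_mono power_mono) (auto simp: field_simps)
    finally have "real (Suc r) * real (edge_count H U) \<le> real l" by simp
    moreover have "2 * real (edge_count H U) \<le> real (Suc r) * real (edge_count H U)"
      using r by (intro mult_right_mono) auto
    ultimately have "2 * real (edge_count H U) \<le> real l" by linarith
    moreover have "real l \<le> real (independence_number (induced H U)) + real (edge_count H U)"
      using independence_number_ge_verts_minus_edges[OF uniform_induced[OF H U(1)]] U(2) by simp
    moreover have "independence_number (induced H U) \<le> independence_number H"
      by (rule independence_number_induced_le[OF H U(1)])
    ultimately have "real l / 2 \<le> real (independence_number H)" by linarith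
    moreover have "real n / (4 * x) = real n / (2 * x) / 2" by simp
    ultimately show ?thesis using l_ge unfolding n_def by linarith
  qed
qed

lemma independence_number_ge_of_sparse_subset:
  fixes x c :: real
  assumes H: "uniform_hypergraph (Suc r) H" and "1 \<le> r" and U: "U \<subseteq> verts H"
    and x: "1 \<le> x" and "avg_degree (Suc r) (induced H U) \<le> x ^ r"
    and c: "4 * x * c \<le> real (card U)"
  shows "c \<le> real (independence_number H)"
proof -
  have "c \<le> real (card U) / (4 * x)" using c x by (simp add: field_simps)
  also have "\<dots> \<le> real (independence_number (induced H U))"
    using Turan_independence_bound[OF uniform_induced[OF H U]] assms by simp
  also have "\<dots> \<le> real (independence_number H)"
    using independence_number_induced_le[OF H U] by simp
  finally show ?thesis .
qed

section \<open>Sparse or nearly regular subsets\<close>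

text \<open>
  Peeling with \<open>a = (r + 1) (1 + \<gamma>)\<close> bounds the average degree by \<open>d q powr (a - 1)\<close>, where \<open>q\<close>
  is the fraction of the vertices that is left. The slightly weaker exponent \<open>r (1 + \<gamma>)\<close> makes the
  \<open>r\<close>-th root of this bound \<open>d powr (1 / r) * q powr (1 + \<gamma>)\<close>.
\<close>

lemma exists_sparse_or_nearly_regular_subset:
  fixes \<gamma> :: real
  assumes H: "uniform_hypergraph (Suc r) H" and \<gamma>: "0 \<le> \<gamma>"
    and l: "1 \<le> l" "l \<le> card (verts H)"
  obtains U where "U \<subseteq> verts H" "l \<le> card U"
    "avg_degree (Suc r) (induced H U) \<le> avg_degree (Suc r) H *
      (real (card U) / real (card (verts H))) powr (real r * (1 + \<gamma>))"
    "card U = l \<or>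
      real (max_degree (induced H U)) \<le> (1 + \<gamma>) * avg_degree (Suc r) (induced H U)"
proof -
  define a where "a = real (Suc r) * (1 + \<gamma>)"
  define n where "n = card (verts H)"
  have a: "1 + real r * (1 + \<gamma>) \<le> a"
    using \<gamma> by (simp add: a_def algebra_simps)
  moreover have "0 \<le> real r * (1 + \<gamma>)" using \<gamma> by simp
  ultimately have "1 \<le> a" by linarith
  from peel_max_degree_vertices[OF H this l, where
      good = "\<lambda>W. real (max_degree (induced H W)) \<le> (1 + \<gamma>) * avg_degree (Suc r) (induced H W)"]
  obtain U where U: "U \<subseteq> verts H" "l \<le> card U" "card U = l \<or>
      real (max_degree (induced H U)) \<le> (1 + \<gamma>) * avg_degree (Suc r) (induced H U)"
    and EU: "real (edge_count H U) \<le> real (card (edges H)) * (real (card U) / real n) powr a"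
    by (auto simp: avg_degree_def a_def n_def field_simps)
  define q where "q = real (card U) / real n"
  have fin: "finite (verts H)" using H by (simp add: uniform_hypergraph_def)
  have n: "0 < n" using l by (simp add: n_def)
  have u: "0 < card U" "card U \<le> n"
    using l U card_mono[OF fin U(1)] by (auto simp: n_def)
  have q: "0 < q" "q \<le> 1" using u n by (auto simp: q_def divide_le_eq)
  have "avg_degree (Suc r) (induced H U) = real (Suc r) * real (edge_count H U) / real (card U)"
    by (simp add: avg_degree_def)
  also have "\<dots> \<le> real (Suc r) * (real (card (edges H)) * q powr a) / real (card U)"
    using EU unfolding q_def by (intro divide_right_mono mult_left_mono) auto
  also have "\<dots> = avg_degree (Suc r) H * (q powr a / q)"
    using u n by (simp add: avg_degree_def q_def n_def)
  also have "q powr a / q = q powr (a - 1)"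
    using q by (simp add: powr_diff)
  also have "avg_degree (Suc r) H * q powr (a - 1)
      \<le> avg_degree (Suc r) H * q powr (real r * (1 + \<gamma>))"
    using a q by (intro mult_left_mono powr_mono') (auto simp: avg_degree_def)
  finally show ?thesis using that U by (simp add: q_def n_def)
qed

section \<open>Nearly logarithmic functions\<close>

lemma nearly_logarithmic_eventually_gt_2:
  assumes "nearly_logarithmic f"
  shows "\<forall>\<^sub>F x in at_top. 2 < f x"
proof -
  have "Liminf at_top (\<lambda>x. ereal (f x)) > 2"
    using assms by (simp add: nearly_logarithmic_def)
  from less_LiminfD[OF this] show ?thesis by simp
qed

text \<open>
  Since \<open>f x\<close> is eventually less than \<open>x powr (1 / (2 * N))\<close>, its \<open>N\<close>-th power is less than the
  square root of \<open>x\<close>, which leaves another square root to absorb \<open>C\<close>.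
\<close>

lemma nearly_logarithmic_eventually_powr_le:
  assumes f: "nearly_logarithmic f" and pos: "f \<in> {0<..} \<rightarrow> {0<..}" and N: "0 < N"
  shows "\<forall>\<^sub>F x in at_top. C * f x powr N \<le> x"
proof -
  have "((\<lambda>x. ln (f x) / ln x) \<longlongrightarrow> 0) at_top"
    using f by (simp add: nearly_logarithmic_def)
  moreover have "0 < 1 / (2 * N)" using N by simp
  ultimately have "\<forall>\<^sub>F x in at_top. ln (f x) / ln x < 1 / (2 * N)"
    by (rule order_tendstoD(2))
  then show ?thesis
    using eventually_gt_at_top[of 1] eventually_ge_at_top[of "C\<^sup>2"]
  proof eventually_elim
    case (elim x)
    have fx: "0 < f x" using pos elim by auto
    have "N * ln (f x) \<le> 1 / 2 * ln x"
      using elim N by (simp add: field_simps)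
    then have "f x powr N \<le> x powr (1 / 2)"
      using fx elim by (simp add: powr_def)
    then have "f x powr N \<le> sqrt x"
      using elim by (simp add: powr_half_sqrt)
    moreover have "C \<le> sqrt x" using elim by (simp add: real_le_rsqrt)
    ultimately have "C * f x powr N \<le> sqrt x * sqrt x"
      using elim by (intro mult_mono) auto
    then show ?case using elim by simp
  qed
qed

text \<open>
  In condition (C2) the number \<open>\<kappa>\<close> may depend on \<open>m\<close>. It can be chosen for all \<open>m\<close> at once: the
  instance \<open>m = 0\<close> provides a \<open>\<kappa>\<close> that covers the arguments \<open>y \<ge> x\<close>, and every \<open>\<kappa> > 1\<close> covers
  the arguments \<open>y \<le> x\<close>.
\<close>

lemma nearly_logarithmic_stable:
  assumes f: "nearly_logarithmic f" and pos: "f \<in> {0<..} \<rightarrow> {0<..}" and \<eta>: "0 < \<eta>"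
  obtains \<kappa> where "1 < \<kappa>"
    "\<forall>m\<ge>0. \<forall>\<^sub>F x in at_top. \<forall>y. x * f x powr (- m) \<le> y \<longrightarrow> y \<le> \<kappa> * x \<longrightarrow>
       (1 - \<eta>) * f x \<le> f y"
proof -
  have C2: "\<exists>l>1. \<forall>\<^sub>F x in at_top. \<forall>y. x * f x powr (- m) \<le> y \<longrightarrow> y \<le> l * x \<longrightarrow>
       (1 - \<eta>) * f x \<le> f y" if "0 \<le> m" for m
  proof -
    have "\<forall>\<epsilon>>0. \<forall>m\<ge>0. \<exists>M>0. \<exists>l>1. \<forall>x>M.
        (INF y\<in>{x * f x powr (- m)..l * x}. ereal (f y / f x)) \<ge> ereal (1 - \<epsilon>)"
      using f unfolding nearly_logarithmic_def by blast
    from this[rule_format, OF \<eta> that] obtain M l where M: "0 < M" "1 < l" and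
      inf: "\<forall>x>M. (INF y\<in>{x * f x powr (- m)..l * x}. ereal (f y / f x)) \<ge> ereal (1 - \<eta>)"
      by (elim exE conjE)
    have "(1 - \<eta>) * f x \<le> f y"
      if "M < x" "x * f x powr (- m) \<le> y" "y \<le> l * x" for x y
    proof -
      have "0 < f x" using pos M that by auto
      moreover have "1 - \<eta> \<le> f y / f x"
        using inf[rule_format, OF that(1)] that by (simp add: le_INF_iff)
      ultimately show ?thesis by (simp add: le_divide_eq)
    qed
    then show ?thesis
      using M(2) by (intro exI[of _ l] conjI eventually_mono[OF eventually_gt_at_top[of M]]) auto
  qed
  obtain \<kappa> where \<kappa>: "1 < \<kappa>" and up: "\<forall>\<^sub>F x in at_top. \<forall>y. x * f x powr (- 0) \<le> y \<longrightarrow>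
      y \<le> \<kappa> * x \<longrightarrow> (1 - \<eta>) * f x \<le> f y"
    using C2[of 0] by auto
  show thesis
  proof (rule that[OF \<kappa>], intro allI impI)
    fix m :: real assume "0 \<le> m"
    then obtain l where l: "1 < l" and down: "\<forall>\<^sub>F x in at_top. \<forall>y. x * f x powr (- m) \<le> y \<longrightarrow>
        y \<le> l * x \<longrightarrow> (1 - \<eta>) * f x \<le> f y"
      using C2 by blast
    show "\<forall>\<^sub>F x in at_top. \<forall>y. x * f x powr (- m) \<le> y \<longrightarrow> y \<le> \<kappa> * x \<longrightarrow>
        (1 - \<eta>) * f x \<le> f y"
      using up down eventually_gt_at_top[of 0]
    proof eventually_elim
      case (elim x)
      have fx: "f x > 0" using pos elim by auto
      show ?case
      proof (intro allI impI)
        fix y assume y: "x * f x powr (- m) \<le> y" "y \<le> \<kappa> * x"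
        show "(1 - \<eta>) * f x \<le> f y"
        proof (cases "x \<le> y")
          case True
          then show ?thesis using elim(1) y fx by simp
        next
          case False
          moreover have "1 * x \<le> l * x" using l elim by (intro mult_right_mono) auto
          ultimately have "y \<le> l * x" by linarith
          then show ?thesis using elim(2) y by blast
        qed
      qed
    qed
  qed
qed

section \<open>From maximum degree to average degree\<close>

text \<open>
  The computation for a nearly regular set with \<open>q * n\<close> vertices and maximum degree \<open>\<Delta>\<close> in a
  hypergraph with \<open>n\<close> vertices and average degree \<open>b ^ r\<close>. The bound on \<open>\<Delta>\<close> gives
  \<open>\<Delta> powr (1 / r) \<le> (1 + \<gamma>) * b * q\<close>, so the fraction \<open>q\<close> cancels. The losses are one factor
  \<open>1 - \<eta>\<close> from the hypothesis on the class, one from the passage between the values of \<open>f\<close>, and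
  \<open>1 / (1 + \<gamma>)\<close> from the irregularity.
\<close>

lemma bound_at_max_degree_imp_bound_at_avg_degree:
  fixes f :: "real \<Rightarrow> real" and \<eta> \<gamma> b q n s \<Delta> \<alpha> :: real
  assumes r: "1 \<le> r" and \<gamma>: "0 \<le> \<gamma>" "\<gamma> \<le> \<eta>" and \<eta>: "\<eta> \<le> 1"
    and b: "0 < b" and q: "0 < q" and s: "0 < s" and n: "0 \<le> n"
    and \<Delta>: "0 < \<Delta>" "\<Delta> \<le> (1 + \<gamma>) * (b * q) ^ r"
    and f: "(1 - \<eta>) * s \<le> f \<Delta>"
    and \<alpha>: "(1 - \<eta>) * (f \<Delta> / \<Delta> powr (1 / real r)) * (q * n) \<le> \<alpha>"
  shows "(1 - 3 * \<eta>) * (s / b) * n \<le> \<alpha>"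
proof -
  have "(1 + \<gamma>) * (b * q) ^ r \<le> (1 + \<gamma>) ^ r * (b * q) ^ r"
    using \<gamma> b q r by (intro mult_right_mono self_le_power) auto
  then have "\<Delta> \<le> ((1 + \<gamma>) * (b * q)) ^ r"
    using \<Delta>(2) by (simp add: power_mult_distrib)
  then have "\<Delta> powr (1 / real r) \<le> (((1 + \<gamma>) * (b * q)) powr real r) powr (1 / real r)"
    using \<gamma> b q \<Delta>(1) by (intro powr_mono2) (auto simp: powr_realpow)
  also have "\<dots> = (1 + \<gamma>) * (b * q)"
    using \<gamma> b q r by (simp add: powr_powr)
  finally have root: "\<Delta> powr (1 / real r) \<le> (1 + \<gamma>) * (b * q)" .
  have "(1 - 3 * \<eta>) * (1 + \<gamma>) \<le> (1 - \<eta>) * (1 - \<eta>)"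
  proof -
    have "(1 - 3 * \<eta>) * (1 + \<gamma>) = (1 - 2 * \<eta>) - (\<eta> - \<gamma>) - 3 * (\<eta> * \<gamma>)"
      by (simp add: algebra_simps)
    also have "\<dots> \<le> 1 - 2 * \<eta>" using \<gamma> mult_nonneg_nonneg[of \<eta> \<gamma>] by linarith
    also have "\<dots> \<le> 1 - 2 * \<eta> + \<eta> * \<eta>" by simp
    also have "\<dots> = (1 - \<eta>) * (1 - \<eta>)" by (simp add: algebra_simps)
    finally show ?thesis .
  qed
  then have "1 - 3 * \<eta> \<le> (1 - \<eta>) * (1 - \<eta>) / (1 + \<gamma>)"
    using \<gamma> by (simp add: le_divide_eq)
  then have "(1 - 3 * \<eta>) * (s / b) * n \<le> (1 - \<eta>) * (1 - \<eta>) / (1 + \<gamma>) * (s / b) * n"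
    using s b n by (intro mult_right_mono) auto
  also have "\<dots> = (1 - \<eta>) * ((1 - \<eta>) * s / ((1 + \<gamma>) * (b * q))) * (q * n)"
    using q by simp
  also have "\<dots> \<le> (1 - \<eta>) * (f \<Delta> / \<Delta> powr (1 / real r)) * (q * n)"
    using root f \<eta> \<gamma> b q s n \<Delta>(1)
    by (intro mult_right_mono mult_left_mono frac_le order_trans[OF _ f] mult_nonneg_nonneg) auto
  also have "\<dots> \<le> \<alpha>" by (rule \<alpha>)
  finally show ?thesis .
qed

theorem theorem1p2:
  fixes r :: nat and f :: "real \<Rightarrow> real" and \<G> :: "'a hypergraph set"
  assumes "r \<ge> 1"
    and "f \<in> {0<..} \<rightarrow> {0<..}"
    and "nearly_logarithmic f"
    and "\<forall>H\<in>\<G>. uniform_hypergraph (r + 1) H"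
    and "hereditary \<G>"
    and "\<forall>\<delta>>0. \<exists>\<Delta>\<^sub>0>0. \<forall>H\<in>\<G>. real (max_degree H) \<ge> \<Delta>\<^sub>0 \<longrightarrow>
           real (independence_number H) \<ge>
             (1 - \<delta>) * (f (real (max_degree H)) / real (max_degree H) powr (1 / real r))
               * real (card (verts H))"
  shows "\<forall>\<epsilon>>0. \<exists>d\<^sub>0>0. \<forall>H\<in>\<G>. avg_degree (r + 1) H \<ge> d\<^sub>0 \<longrightarrow>
           real (independence_number H) \<ge>
             (1 - \<epsilon>) * (f (avg_degree (r + 1) H) / avg_degree (r + 1) H powr (1 / real r))
               * real (card (verts H))"
proof (intro allI impI)
  fix \<epsilon> :: real assume "0 < \<epsilon>"
  define \<eta> where "\<eta> = min (\<epsilon> / 3) (1 / 3)"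
  have \<eta>: "0 < \<eta>" "\<eta> \<le> 1 / 3" "3 * \<eta> \<le> \<epsilon>" using \<open>0 < \<epsilon>\<close> by (auto simp: \<eta>_def)
  obtain \<kappa> where \<kappa>: "1 < \<kappa>" and stable:
    "\<forall>m\<ge>0. \<forall>\<^sub>F x in at_top. \<forall>y. x * f x powr (- m) \<le> y \<longrightarrow> y \<le> \<kappa> * x \<longrightarrow>
       (1 - \<eta>) * f x \<le> f y"
    by (rule nearly_logarithmic_stable[OF assms(3,2) \<eta>(1)])
  obtain \<Delta>\<^sub>0 where \<Delta>\<^sub>0: "0 < \<Delta>\<^sub>0" "\<And>H. H \<in> \<G> \<Longrightarrow> real (max_degree H) \<ge> \<Delta>\<^sub>0 \<Longrightarrow>
      (1 - \<eta>) * (f (real (max_degree H)) / real (max_degree H) powr (1 / real r))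
               * real (card (verts H)) \<le> real (independence_number H)"
    using assms(6) \<eta>(1) by blast
  define \<gamma> where "\<gamma> = min \<eta> (\<kappa> - 1)"
  have \<gamma>: "0 < \<gamma>" "\<gamma> \<le> \<eta>" "1 + \<gamma> \<le> \<kappa>" "\<gamma> \<le> 1" using \<eta> \<kappa> by (auto simp: \<gamma>_def)
  \<comment> \<open>A set of at most \<open>2 n f(d) powr (- m) \<le> n f(d) powr (- (m - 1))\<close> vertices must gain the factor
    \<open>f(d) ^ 3\<close> by \<open>q powr (- \<gamma>)\<close>, whence \<open>(m - 1) \<gamma> = 3\<close>. A nearly regular set counts as extremely
    sparse when the root of its average degree is below \<open>f(d) powr (- N)\<close> times that of \<open>d\<close>. It
    has at least \<open>n f(d) powr (- m)\<close> vertices, so \<open>N = m + 4\<close> leaves the factor \<open>f(d) ^ 4\<close>.\<close>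
  define m where "m = 1 + 3 / \<gamma>"
  define N where "N = m + 4"
  have m: "1 < m" "(m - 1) * \<gamma> = 3" "m * (1 + \<gamma>) \<le> N"
    using \<gamma> by (auto simp: m_def N_def field_simps)
  have r: "0 < real r" using assms(1) by simp
  have rN: "0 < real r * N" using r m by (simp add: N_def)
  have "\<forall>\<^sub>F d in at_top. 2 < f d"
    by (rule nearly_logarithmic_eventually_gt_2[OF assms(3)])
  moreover have "\<forall>\<^sub>F d in at_top. 1 * f d powr (real r * N) \<le> d"
    by (rule nearly_logarithmic_eventually_powr_le[OF assms(3,2) rN])
  moreover have "\<forall>\<^sub>F d in at_top. \<Delta>\<^sub>0 * f d powr (real r * N) \<le> d"
    by (rule nearly_logarithmic_eventually_powr_le[OF assms(3,2) rN])
  moreover have "\<forall>\<^sub>F d in at_top. \<forall>y. d * f d powr (- (real r * N)) \<le> y \<longrightarrow>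
      y \<le> \<kappa> * d \<longrightarrow> (1 - \<eta>) * f d \<le> f y"
    using stable rN less_imp_le by blast
  ultimately have "\<forall>\<^sub>F d in at_top. 2 < f d \<and> 1 * f d powr (real r * N) \<le> d \<and>
      \<Delta>\<^sub>0 * f d powr (real r * N) \<le> d \<and>
      (\<forall>y. d * f d powr (- (real r * N)) \<le> y \<longrightarrow> y \<le> \<kappa> * d \<longrightarrow> (1 - \<eta>) * f d \<le> f y)"
    by (intro eventually_conj)
  then obtain d\<^sub>0 where d\<^sub>0: "\<forall>d\<ge>d\<^sub>0. 2 < f d \<and> 1 * f d powr (real r * N) \<le> d \<and>
      \<Delta>\<^sub>0 * f d powr (real r * N) \<le> d \<and>
      (\<forall>y. d * f d powr (- (real r * N)) \<le> y \<longrightarrow> y \<le> \<kappa> * d \<longrightarrow> (1 - \<eta>) * f d \<le> f y)"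
    unfolding eventually_at_top_linorder by blast
  have "real (independence_number H) \<ge>
             (1 - \<epsilon>) * (f (avg_degree (r + 1) H) / avg_degree (r + 1) H powr (1 / real r))
               * real (card (verts H))"
    if HG: "H \<in> \<G>" and large: "max 1 d\<^sub>0 \<le> avg_degree (r + 1) H" for H
  proof -
    have H: "uniform_hypergraph (Suc r) H" using assms(4) HG by simp
    define d where "d = avg_degree (Suc r) H"
    define s where "s = f d"
    define n where "n = card (verts H)"
    define b where "b = d powr (1 / real r)"
    have d: "1 \<le> d" "d\<^sub>0 \<le> d" using large by (auto simp: d_def)
    have s: "2 < s" "s powr (real r * N) \<le> d" "\<Delta>\<^sub>0 * s powr (real r * N) \<le> d"
      and fy: "\<And>y. d * s powr (- (real r * N)) \<le> y \<Longrightarrow> y \<le> \<kappa> * d \<Longrightarrow> (1 - \<eta>) * s \<le> f y"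
      using d\<^sub>0[rule_format, OF d(2)] unfolding s_def by simp_all
    have b: "0 < b" "b ^ r = d"
      using d r by (auto simp: b_def powr_powr simp flip: powr_realpow)
    have n: "0 < n" using d(1) by (auto simp: d_def n_def avg_degree_def intro: gr0I)
    have "(s powr N) ^ r = s powr (real r * N)"
      using s by (simp add: powr_powr mult.commute flip: powr_realpow)
    then have sb: "s powr N \<le> b"
      using s b assms(1) by (intro power_le_imp_le_base[of "s powr N" "r - 1" b]) auto
    have "b ^ r \<le> real n ^ r"
      unfolding b(2) d_def n_def by (rule avg_degree_le_power[OF H])
    then have bn: "b \<le> real n"
      using b assms(1) by (intro power_le_imp_le_base[of b "r - 1" "real n"]) auto
    have goal: ?thesis if "(1 - 3 * \<eta>) * (s / b) * real n \<le> real (independence_number H)"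
    proof -
      have "(1 - \<epsilon>) * (s / b) * real n \<le> (1 - 3 * \<eta>) * (s / b) * real n"
        using \<eta> s b by (intro mult_right_mono) auto
      then show ?thesis using that by (simp add: s_def b_def d_def n_def)
    qed
    have goal_Turan: ?thesis if "s * real n / b \<le> real (independence_number H)"
    proof -
      have "(1 - 3 * \<eta>) * (s / b) * real n \<le> 1 * (s / b) * real n"
        using \<eta> s b by (intro mult_right_mono) auto
      then show ?thesis using that by (intro goal) simp
    qed
    \<comment> \<open>The process never goes below \<open>l\<close> vertices. As \<open>n \<ge> d powr (1 / r) \<ge> s powr N\<close>, the
      number that is rounded up to \<open>l\<close> is at least 1, and rounding costs at most a factor 2.\<close>
    define l where "l = nat \<lceil>real n * s powr (- m)\<rceil>"
    have "s powr m \<le> s powr N" using s by (intro powr_mono) (auto simp: N_def)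
    then have "s powr m \<le> real n" using sb bn by linarith
    then have nsm: "1 \<le> real n * s powr (- m)"
      using s by (simp add: powr_minus field_simps)
    have sm1: "s powr (- m) \<le> 1" using s m powr_mono[of "-m" 0 s] by simp
    have "real n * s powr (- m) \<le> real n * 1" using sm1 by (intro mult_left_mono) auto
    then have l: "1 \<le> l" "l \<le> n" "real n * s powr (- m) \<le> real l"
      "real l \<le> 2 * (real n * s powr (- m))"
      using nsm unfolding l_def by linarith+
    obtain U where U: "U \<subseteq> verts H" "l \<le> card U" and
      DU: "avg_degree (Suc r) (induced H U) \<le> d * (real (card U) / real n) powr (real r * (1 + \<gamma>))"
      and stop: "card U = l \<or>
        real (max_degree (induced H U)) \<le> (1 + \<gamma>) * avg_degree (Suc r) (induced H U)"
      using exists_sparse_or_nearly_regular_subset[OF H, of \<gamma> l] \<gamma>(1) l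
      unfolding d_def n_def by (metis less_imp_le)
    define D where "D = avg_degree (Suc r) (induced H U)"
    define q where "q = real (card U) / real n"
    have u: "real (card U) = q * real n" using n by (simp add: q_def)
    have fin: "finite (verts H)" using H by (simp add: uniform_hypergraph_def)
    have "card U \<le> n" using card_mono[OF fin U(1)] by (simp add: n_def)
    then have q: "0 < q" "q \<le> 1" using U l n by (auto simp: q_def divide_le_eq)
    have "s powr (- m) * real n \<le> q * real n"
      using l(3) U(2) unfolding u[symmetric] by (simp add: mult.commute)
    then have q_ge: "s powr (- m) \<le> q" using n by simp
    have Dq: "D \<le> (b * q powr (1 + \<gamma>)) ^ r"
      using DU b q unfolding D_def[symmetric] q_def[symmetric]
      by (simp add: power_mult_distrib powr_powr mult.commute flip: powr_realpow)
    have q\<gamma>: "q powr (1 + \<gamma>) \<le> q" using powr_mono'[of 1 "1 + \<gamma>" q] q \<gamma> by simp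
    have s4: "4 * s \<le> s powr 3"
    proof -
      have "2 * 2 * s \<le> s * s * s" using s by (intro mult_mono) auto
      then show ?thesis using s by (simp add: power3_eq_cube)
    qed
    show ?thesis
    proof (cases "real (max_degree (induced H U)) \<le> (1 + \<gamma>) * D")
      case near_regular: True
      show ?thesis
      proof (cases "d * s powr (- (real r * N)) \<le> D")
        case True
        define \<Delta> where "\<Delta> = real (max_degree (induced H U))"
        have D\<Delta>: "D \<le> \<Delta>"
          unfolding D_def \<Delta>_def by (rule avg_degree_le_max_degree[OF uniform_induced[OF H U(1)]])
        have "\<Delta>\<^sub>0 \<le> d * s powr (- (real r * N))"
          using s by (simp add: powr_minus field_simps)
        then have \<Delta>_ge: "\<Delta>\<^sub>0 \<le> \<Delta>" using True D\<Delta> by linarith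
        have "(b * q powr (1 + \<gamma>)) ^ r \<le> (b * q) ^ r"
          using b q q\<gamma> by (intro power_mono mult_left_mono) auto
        then have Dbq: "D \<le> (b * q) ^ r" using Dq by linarith
        also have "\<dots> \<le> b ^ r" using b q by (intro power_mono) (auto simp: mult_left_le)
        finally have Dd: "D \<le> d" using b by simp
        have "0 \<le> D" by (simp add: D_def avg_degree_def)
        have "\<Delta> \<le> (1 + \<gamma>) * D" using near_regular by (simp add: \<Delta>_def)
        also have "\<dots> \<le> \<kappa> * d" using \<gamma> Dd d \<open>0 \<le> D\<close> by (intro mult_mono) auto
        finally have f\<Delta>: "(1 - \<eta>) * s \<le> f \<Delta>" using fy[of \<Delta>] True D\<Delta> by linarith
        have "induced H U \<in> \<G>" using assms(5) HG U(1) by (simp add: hereditary_def)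
        then have "(1 - \<eta>) * (f \<Delta> / \<Delta> powr (1 / real r)) * real (card U)
            \<le> real (independence_number (induced H U))"
          using \<Delta>\<^sub>0(2)[of "induced H U"] \<Delta>_ge by (simp add: \<Delta>_def)
        then have "(1 - \<eta>) * (f \<Delta> / \<Delta> powr (1 / real r)) * (q * real n)
            \<le> real (independence_number H)"
          using independence_number_induced_le[OF H U(1)] unfolding u by linarith
        moreover have "\<Delta> \<le> (1 + \<gamma>) * (b * q) ^ r"
          using near_regular mult_left_mono[OF Dbq, of "1 + \<gamma>"] \<gamma> unfolding \<Delta>_def by linarith
        ultimately show ?thesis
          using assms(1) \<gamma> \<eta> b q s \<Delta>\<^sub>0(1) \<Delta>_ge f\<Delta>
          by (intro goal bound_at_max_degree_imp_bound_at_avg_degree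
              [where f = f and \<gamma> = \<gamma> and q = q and \<Delta> = \<Delta> and r = r]) auto
      next
        case False
        \<comment> \<open>Extreme sparseness outweighs the loss of vertices, which is at most \<open>s powr (- m)\<close>.\<close>
        have "D \<le> (b * s powr (- N)) ^ r"
          using False b s by (simp add: power_mult_distrib powr_powr mult.commute flip: powr_realpow)
        moreover have "1 \<le> b * s powr (- N)"
          using sb s by (simp add: powr_minus field_simps)
        moreover have "4 * (b * s powr (- N)) * (s * real n / b) \<le> real (card U)"
        proof -
          have "4 * s * s powr (- N) \<le> s powr 3 * s powr (- N)"
            using s4 by (intro mult_right_mono) auto
          also have "\<dots> = s powr (3 + - N)" by (simp only: powr_add)
          also have "\<dots> \<le> s powr (- m)" using s by (intro powr_mono) (auto simp: N_def)
          also have "\<dots> \<le> q" by (rule q_ge)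
          finally have "4 * s * s powr (- N) * real n \<le> q * real n"
            by (intro mult_right_mono) auto
          then show ?thesis using b unfolding u by (simp add: mult_ac)
        qed
        ultimately show ?thesis
          using independence_number_ge_of_sparse_subset[OF H assms(1) U(1)] goal_Turan
          unfolding D_def by blast
      qed
    next
      case False
      \<comment> \<open>No nearly regular set was met, so the gain \<open>q powr (- \<gamma>)\<close> in value has accumulated.\<close>
      then have "card U = l" using stop unfolding D_def by blast
      then have "q * real n \<le> 2 * s powr (- m) * real n"
        using l(4) u by (simp add: mult_ac)
      then have "q \<le> 2 * s powr (- m)" using n by simp
      also have "\<dots> \<le> s * s powr (- m)" using s by (intro mult_right_mono) auto
      also have "\<dots> = s powr (- (m - 1))" using s powr_add[of s 1 "- m"] by simp
      finally have "q powr \<gamma> \<le> (s powr (- (m - 1))) powr \<gamma>"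
        using q \<gamma> by (intro powr_mono2) auto
      also have "\<dots> = s powr (- 3)"
        using m(2) by (simp only: powr_powr mult_minus_left)
      finally have q_small: "q powr \<gamma> \<le> s powr (- 3)" .
      have "s powr (- N) \<le> s powr (- m * (1 + \<gamma>))" using s m(3) by (intro powr_mono) auto
      also have "\<dots> = (s powr (- m)) powr (1 + \<gamma>)" by (simp add: powr_powr)
      also have "\<dots> \<le> q powr (1 + \<gamma>)" using q_ge \<gamma> by (intro powr_mono2) auto
      finally have "b * s powr (- N) \<le> b * q powr (1 + \<gamma>)" using b by simp
      moreover have "1 \<le> b * s powr (- N)"
        using sb s by (simp add: powr_minus field_simps)
      ultimately have "1 \<le> b * q powr (1 + \<gamma>)" by linarith
      moreover have "4 * (b * q powr (1 + \<gamma>)) * (s * real n / b) \<le> real (card U)"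
      proof -
        have "4 * s * q powr \<gamma> \<le> s powr 3 * s powr (- 3)"
          using s4 q_small by (intro mult_mono) auto
        also have "\<dots> = 1" using s by (simp add: powr_minus)
        finally have "4 * s * q powr \<gamma> * (q * real n) \<le> 1 * (q * real n)"
          using q by (intro mult_right_mono) auto
        then show ?thesis using b q unfolding u by (simp add: powr_add mult_ac)
      qed
      ultimately show ?thesis
        using independence_number_ge_of_sparse_subset[OF H assms(1) U(1)] goal_Turan Dq
        unfolding D_def by blast
    qed
  qed
  then show "\<exists>d\<^sub>0>0. \<forall>H\<in>\<G>. avg_degree (r + 1) H \<ge> d\<^sub>0 \<longrightarrow>
           real (independence_number H) \<ge>
             (1 - \<epsilon>) * (f (avg_degree (r + 1) H) / avg_degree (r + 1) H powr (1 / real r))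
               * real (card (verts H))"
    by (intro exI[of _ "max 1 d\<^sub>0"]) auto
qed

end
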